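(* For every $d\ge1$, $$\operatorname{trop}(\mathcal{B}\mathcal{P}_{2d}^* )=\operatorname{tcone}\bigl(\tilde\nu_d(\operatorname{trop}(\mathcal{N}_d))\bigr).$$
   Context: $\mathcal{N}_d\subset\mathbb{R}_{\ge0}^d$ is the closure of $\bigcup_{n\ge1}\{(p_2(x),p_4(x),\dots,p_{2d}(x)):x\in\mathbb{R}^n\}$, where $p_k(x)=x_1^k+\cdots+x_n^k$. Let $\Lambda_{2d}^{\varepsilon}$ be the set of partitions of $2d$ with all parts even, identified with the set of partitions of $d$ by halving all parts; its cardinality is $\pi(d)$, the number of partitions of $d$. The linear map $\tilde\nu_d:\mathbb{R}^d\to\mathbb{R}^{\pi(d)}$ is given by $\tilde\nu_d(x)_\lambda=\sum_{i}x_{\lambda_i}$ for each partition $\lambda$ of $d$ (it is the tropicalization of the monomial map $x\mapsto(\prod_i x_{\lambda_i})_{\lambda\vdash d}$); the coordinate indexed by $\lambda\vdash d$ corresponds to the even partition $2\lambda\in\Lambda_{2d}^\varepsilon$. For a partition $\lambda$, $p_\lambda=\prod_i p_{\lambda_i}$. $\mathcal{B}\mathcal{P}_{2d}$ is the set of $c\in\mathbb{R}^{\Lambda_{2d}^\varepsilon}$ such that for every $n\ge2d$ the form $\sum_\lambda c_\lambda p_\lambda(X_1,\dots,X_n)$ is nonnegative on $\mathbb{R}^n$, and $\mathcal{B}\mathcal{P}_{2d}^*=\{\varphi\in\mathbb{R}^{\Lambda_{2d}^\varepsilon}:\sum_\lambda c_\lambda\varphi_\lambda\ge0\ \text{for all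 } c\in\mathcal{B}\mathcal{P}_{2d}\}$, which lies in the nonnegative orthant. For $S\subset\mathbb{R}_{\ge0}^s$, $\operatorname{trop}(S)=\lim_{t\to\infty}\log_t(S\cap\mathbb{R}_{>0}^s)$ with $\log_t$ applied coordinatewise; equivalently $y\in\operatorname{trop}(S)$ iff there are sequences $x^{(m)}\in S\cap\mathbb{R}_{>0}^s$ and $\tau_m\in(0,1)$ with $\tau_m\to0$ and $y=\lim_{m\to\infty}\log_{1/\tau_m}(x^{(m)})$. Tropical operations: $x\oplus y$ is the coordinatewise maximum, and $a\odot x=(a+x_1,\dots,a+x_n)$ for $a\in\mathbb{R}$. The tropical conical hull of $M\subset\mathbb{R}^n$ is $\operatorname{tcone}(M)=\{(a_1\odot x_1)\oplus\cdots\oplus(a_l\odot x_l): l\in\mathbb{N}_{>0},\ a_i\in\mathbb{R},\ x_i\in M\}$. *)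

theory Defs
  imports "HOL-Analysis.Analysis"
begin

text \<open>
  Real coordinate spaces over a finite index set \<open>I\<close> are represented by
  \<open>I \<rightarrow>\<^sub>E UNIV\<close>, the extensional functions from \<open>I\<close> to the reals.
  Partitions are multisets of positive natural numbers.
\<close>

definition partitions :: "nat \<Rightarrow> nat multiset set" where
  "partitions d = {\<mu>. 0 \<notin># \<mu> \<and> sum_mset \<mu> = d}"

definition even_partitions :: "nat \<Rightarrow> nat multiset set" where
  "even_partitions m = {\<mu> \<in> partitions m. \<forall>k\<in>#\<mu>. even k}"

lemma finite_partitions: "finite (partitions d)"
proof (rule finite_subset)
  show "partitions d \<subseteq> mset ` {xs. set xs \<subseteq> {..d} \<and> length xs \<le> d}"
  proof
    fix \<mu> assume "\<mu> \<in> partitions d"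
    then have nz: "0 \<notin># \<mu>" and s: "sum_mset \<mu> = d"
      by (auto simp: partitions_def)
    obtain xs where xs: "mset xs = \<mu>" using ex_mset by blast
    have sl: "sum_list xs = d" using s xs sum_mset_sum_list by metis
    have "set xs \<subseteq> {..d}" using member_le_sum_list sl by auto
    moreover have "length ys \<le> sum_list ys" if "0 \<notin> set ys" for ys :: "nat list"
      using that by (induction ys) auto
    then have "length xs \<le> d" using nz xs sl by (metis set_mset_mset)
    ultimately show "\<mu> \<in> mset ` {xs. set xs \<subseteq> {..d} \<and> length xs \<le> d}"
      using xs by blast
  qed
qed (simp add: finite_lists_length_le)

lemma finite_even_partitions: "finite (even_partitions m)"
  by (rule finite_subset[OF _ finite_partitions[of m]]) (auto simp: even_partitions_def)

lemma bij_betw_halving: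
  "bij_betw (image_mset (\<lambda>k. k div 2)) (even_partitions (2 * d)) (partitions d)"
proof (rule bij_betw_byWitness[where f' = "image_mset (\<lambda>k. 2 * k)"])
  have double: "image_mset (\<lambda>k. 2 * (k div 2)) \<mu> = \<mu>" if "\<forall>k\<in>#\<mu>. even k" for \<mu> :: "nat multiset"
    using that by (induction \<mu>) auto
  then show "\<forall>\<mu>\<in>even_partitions (2 * d).
      image_mset (\<lambda>k. 2 * k) (image_mset (\<lambda>k. k div 2) \<mu>) = \<mu>"
    by (simp add: even_partitions_def multiset.map_comp o_def)
  show "\<forall>\<mu>\<in>partitions d. image_mset (\<lambda>k. k div 2) (image_mset (\<lambda>k. 2 * k) \<mu>) = \<mu>"
    by (simp add: multiset.map_comp o_def)
  show "image_mset (\<lambda>k. k div 2) ` even_partitions (2 * d) \<subseteq> partitions d"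
  proof (intro image_subsetI)
    fix \<mu> assume mu: "\<mu> \<in> even_partitions (2 * d)"
    have "2 * sum_mset (image_mset (\<lambda>k. k div 2) \<mu>) = sum_mset (image_mset (\<lambda>k. 2 * (k div 2)) \<mu>)"
      by (simp add: sum_mset_distrib_left multiset.map_comp o_def)
    with mu double show "image_mset (\<lambda>k. k div 2) \<mu> \<in> partitions d"
      by (auto simp: even_partitions_def partitions_def elim!: evenE)
  qed
  show "image_mset (\<lambda>k. 2 * k) ` partitions d \<subseteq> even_partitions (2 * d)"
    by (auto simp: even_partitions_def partitions_def simp flip: sum_mset_distrib_left)
qed

text \<open>A point of \<open>\<real>\<^sup>n\<close> is given by the first \<open>n\<close> values of a sequence \<open>x\<close>.\<close>

definition power_sum :: "nat \<Rightarrow> nat \<Rightarrow> (nat \<Rightarrow> real) \<Rightarrow> real" where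
  "power_sum k n x = (\<Sum>i<n. x i ^ k)"

definition power_sum_partition :: "nat multiset \<Rightarrow> nat \<Rightarrow> (nat \<Rightarrow> real) \<Rightarrow> real" where
  "power_sum_partition \<mu> n x = (\<Prod>k\<in>#\<mu>. power_sum k n x)"

text \<open>
  The closure below is taken in the product topology on \<^typ>\<open>nat \<Rightarrow> real\<close>.
  As \<open>{1..d} \<rightarrow>\<^sub>E UNIV\<close> is a closed subspace homeomorphic to \<open>\<real>\<^sup>d\<close>,
  this is the Euclidean closure.
\<close>

definition even_power_sum_region :: "nat \<Rightarrow> (nat \<Rightarrow> real) set" where
  "even_power_sum_region d =
     closure (\<Union>n\<in>{1..}. range (\<lambda>x::nat \<Rightarrow> real. \<lambda>k\<in>{1..d}. power_sum (2 * k) n x))"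

definition BP :: "nat \<Rightarrow> (nat multiset \<Rightarrow> real) set" where
  "BP d = {c \<in> even_partitions (2 * d) \<rightarrow>\<^sub>E UNIV.
     \<forall>n\<ge>2 * d. \<forall>x::nat \<Rightarrow> real.
       (\<Sum>\<mu>\<in>even_partitions (2 * d). c \<mu> * power_sum_partition \<mu> n x) \<ge> 0}"

definition BP_dual :: "nat \<Rightarrow> (nat multiset \<Rightarrow> real) set" where
  "BP_dual d = {\<phi> \<in> even_partitions (2 * d) \<rightarrow>\<^sub>E UNIV.
     \<forall>c\<in>BP d. (\<Sum>\<mu>\<in>even_partitions (2 * d). c \<mu> * \<phi> \<mu>) \<ge> 0}"

text \<open>The logarithmic limit set of \<open>S \<subseteq> I \<rightarrow>\<^sub>E UNIV\<close>, described by sequences.\<close>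

definition trop :: "'i set \<Rightarrow> ('i \<Rightarrow> real) set \<Rightarrow> ('i \<Rightarrow> real) set" where
  "trop I S = {y \<in> I \<rightarrow>\<^sub>E UNIV.
     \<exists>(x :: nat \<Rightarrow> 'i \<Rightarrow> real) (\<tau> :: nat \<Rightarrow> real).
       (\<forall>m. x m \<in> S \<and> (\<forall>i\<in>I. x m i > 0)) \<and>
       (\<forall>m. 0 < \<tau> m \<and> \<tau> m < 1) \<and> \<tau> \<longlonglongrightarrow> 0 \<and>
       (\<forall>i\<in>I. (\<lambda>m. log (1 / \<tau> m) (x m i)) \<longlonglongrightarrow> y i)}"

definition tcone :: "'i set \<Rightarrow> ('i \<Rightarrow> real) set \<Rightarrow> ('i \<Rightarrow> real) set" where
  "tcone I M = {y. \<exists>(l :: nat) (a :: nat \<Rightarrow> real) (x :: nat \<Rightarrow> 'i \<Rightarrow> real).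
     l > 0 \<and> (\<forall>j<l. x j \<in> M) \<and> y = (\<lambda>i\<in>I. MAX j\<in>{..<l}. a j + x j i)}"

definition trop_nu :: "nat \<Rightarrow> (nat \<Rightarrow> real) \<Rightarrow> nat multiset \<Rightarrow> real" where
  "trop_nu d x = (\<lambda>\<mu>\<in>partitions d. \<Sum>k\<in>#\<mu>. x k)"

text \<open>
  The identification of coordinates: the value at an even partition \<open>\<mu>\<close> of \<open>2d\<close> is
  the value at the partition of \<open>d\<close> obtained by halving all parts of \<open>\<mu>\<close>.
\<close>

definition along_halving :: "nat \<Rightarrow> (nat multiset \<Rightarrow> real) \<Rightarrow> nat multiset \<Rightarrow> real" where
  "along_halving d y = (\<lambda>\<mu>\<in>even_partitions (2 * d). y (image_mset (\<lambda>k. k div 2) \<mu>))"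

end

theory Submission
  imports Defs
begin

text \<open>
  Given \<open>\<phi>\<close> in the dual cone and a partition \<open>\<nu>\<close>, some point \<open>x\<close> satisfies
  \<open>p\<^sub>\<mu>(x) / p\<^sub>\<nu>(x) \<le> C \<cdot> \<phi>\<^sub>\<mu> / \<phi>\<^sub>\<nu>\<close> for all \<open>\<mu>\<close>, with \<open>C\<close> depending only on \<open>d\<close>: otherwise
  an explicit element of \<open>BP d\<close> pairs negatively with \<open>\<phi>\<close>. Taking logarithms and a limit point,
  every \<open>y\<close> in the tropicalized dual cone dominates, for each coordinate \<open>\<nu>\<close>, a translate of a
  point of \<open>trop_nu d ` trop {1..d} (even_power_sum_region d)\<close> that agrees with \<open>y\<close> at \<open>\<nu>\<close>, so \<open>y\<close> is the maximum of these translates.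
  The limit point is finite because the power sums of a point with \<open>p\<^sub>2 = 1\<close> are log-convex and
  decreasing, unless \<open>\<nu> = (2, \<dots>, 2)\<close>, where \<open>n\<close> equal coordinates serve instead.
  Conversely, tropical combinations lift to conical combinations of points taken at a common scale,
  which exist since the even power sum vectors are closed under coordinatewise products.
\<close>

section \<open>Logarithmic limit sets and tropical cones\<close>

text \<open>With \<open>T = ln (1 / \<tau>)\<close> the logarithm to base \<open>1 / \<tau>\<close>
  is \<open>ln\<close> divided by \<open>T\<close>, so the sequences can be traded for
  approximations at arbitrarily large scales \<open>T\<close>. Finiteness of \<open>I\<close> makes
  the approximation uniform in the coordinates.\<close>

lemma trop_iff:
  assumes "finite I"
  shows "y \<in> trop I S \<longleftrightarrow> y \<in> I \<rightarrow>\<^sub>E UNIV \<and>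
    (\<forall>\<eta>>0. \<forall>T0. \<exists>T>T0. \<exists>x\<in>S. \<forall>i\<in>I. x i > 0 \<and> \<bar>ln (x i) / T - y i\<bar> < \<eta>)"
    (is "?L \<longleftrightarrow> _ \<and> ?R")
proof (intro iffI conjI)
  assume y: ?L
  then show "y \<in> I \<rightarrow>\<^sub>E UNIV" by (simp add: trop_def)
  from y obtain x \<tau> where x: "\<And>m. x m \<in> S" "\<And>m i. i \<in> I \<Longrightarrow> x m i > 0"
    and \<tau>: "\<And>m. 0 < \<tau> m" "\<And>m. \<tau> m < 1" "\<tau> \<longlonglongrightarrow> 0"
    and lim: "\<And>i. i \<in> I \<Longrightarrow> (\<lambda>m. log (1 / \<tau> m) (x m i)) \<longlonglongrightarrow> y i"
    unfolding trop_def by blast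
  show ?R
  proof (intro allI impI)
    fix \<eta> T0 :: real assume "\<eta> > 0"
    have "\<forall>\<^sub>F m in sequentially. \<forall>i\<in>I. \<bar>log (1 / \<tau> m) (x m i) - y i\<bar> < \<eta>"
      using lim \<open>\<eta> > 0\<close> by (intro eventually_ball_finite assms) (auto simp: tendsto_iff dist_real_def)
    moreover have "\<forall>\<^sub>F m in sequentially. \<tau> m < exp (- T0)"
      using \<tau>(3) by (rule order_tendstoD) simp
    ultimately have "\<forall>\<^sub>F m in sequentially.
        (\<forall>i\<in>I. \<bar>log (1 / \<tau> m) (x m i) - y i\<bar> < \<eta>) \<and> \<tau> m < exp (- T0)"
      by (rule eventually_conj)
    then obtain m where m: "\<forall>i\<in>I. \<bar>log (1 / \<tau> m) (x m i) - y i\<bar> < \<eta>" "\<tau> m < exp (- T0)"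
      by (auto dest: eventually_happens)
    have "ln (\<tau> m) < - T0" using m(2) \<tau>(1)[of m] by (metis ln_exp ln_less_cancel_iff exp_gt_zero)
    then have "ln (1 / \<tau> m) > T0" using \<tau>(1)[of m] by (simp add: ln_div)
    then show "\<exists>T>T0. \<exists>x\<in>S. \<forall>i\<in>I. x i > 0 \<and> \<bar>ln (x i) / T - y i\<bar> < \<eta>"
      using m(1) x unfolding log_def by blast
  qed
next
  assume R: "y \<in> I \<rightarrow>\<^sub>E UNIV \<and> ?R"
  have "\<forall>m::nat. \<exists>T x. T > real m \<and> x \<in> S \<and>
      (\<forall>i\<in>I. x i > 0 \<and> \<bar>ln (x i) / T - y i\<bar> < 1 / (real m + 1))"
  proof
    fix m :: nat
    have "1 / (real m + 1) > 0" by simp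
    with R show "\<exists>T x. T > real m \<and> x \<in> S \<and>
      (\<forall>i\<in>I. x i > 0 \<and> \<bar>ln (x i) / T - y i\<bar> < 1 / (real m + 1))"
      by meson
  qed
  then obtain T :: "nat \<Rightarrow> real" and x where T: "\<And>m. T m > real m" and x: "\<And>m. x m \<in> S"
    "\<And>m i. i \<in> I \<Longrightarrow> x m i > 0 \<and> \<bar>ln (x m i) / T m - y i\<bar> < 1 / (real m + 1)"
    by metis
  define \<tau> where "\<tau> m = exp (- T m)" for m
  have Tpos: "T m > 0" for m using T[of m] by linarith
  have "filterlim T at_top sequentially"
    by (rule filterlim_at_top_mono[OF filterlim_real_sequentially])
      (use T in \<open>auto intro!: always_eventually less_imp_le\<close>)
  then have "\<tau> \<longlonglongrightarrow> 0"
    unfolding \<tau>_def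
    by (intro filterlim_compose[OF exp_at_bot]) (simp add: filterlim_uminus_at_bot)
  moreover have "(\<lambda>m. log (1 / \<tau> m) (x m i)) \<longlonglongrightarrow> y i" if "i \<in> I" for i
  proof -
    have "log (1 / \<tau> m) (x m i) = ln (x m i) / T m" for m
      by (simp add: log_def \<tau>_def ln_div)
    moreover have "(\<lambda>m. ln (x m i) / T m - y i) \<longlonglongrightarrow> 0"
    proof (rule Lim_null_comparison)
      show "\<forall>\<^sub>F m in sequentially. norm (ln (x m i) / T m - y i) \<le> 1 / (real m + 1)"
        using x(2)[OF that] by (auto intro!: always_eventually less_imp_le)
      show "(\<lambda>m. 1 / (real m + 1)) \<longlonglongrightarrow> 0"
        using LIMSEQ_inverse_real_of_nat by (simp add: inverse_eq_divide add.commute)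
    qed
    ultimately show ?thesis by (simp add: LIM_zero_iff)
  qed
  ultimately show ?L
    unfolding trop_def
    by (intro CollectI conjI exI[of _ x] exI[of _ \<tau>]) (use R x Tpos in \<open>auto simp: \<tau>_def\<close>)
qed

text \<open>Each translate chosen for a coordinate \<open>i\<close> lies below \<open>y\<close> and
  touches it at \<open>i\<close>, so the maximum of these translates over all \<open>i\<close> is
  \<open>y\<close>. As \<open>I\<close> is nonempty, the number of terms is positive.\<close>

lemma tcone_of_pointwise:
  assumes "finite I" "I \<noteq> {}" "y \<in> I \<rightarrow>\<^sub>E UNIV"
    and "\<And>i. i \<in> I \<Longrightarrow> \<exists>a. \<exists>x\<in>M. (\<forall>j\<in>I. a + x j \<le> y j) \<and> a + x i = y i"
  shows "y \<in> tcone I M"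
proof -
  have "\<forall>i\<in>I. \<exists>p. snd p \<in> M \<and> (\<forall>j\<in>I. fst p + snd p j \<le> y j) \<and> fst p + snd p i = y i"
  proof
    fix i assume "i \<in> I"
    then obtain a x where "x \<in> M" "\<forall>j\<in>I. a + x j \<le> y j" "a + x i = y i"
      using assms(4) by blast
    then show "\<exists>p. snd p \<in> M \<and> (\<forall>j\<in>I. fst p + snd p j \<le> y j) \<and> fst p + snd p i = y i"
      by (intro exI[of _ "(a, x)"]) simp
  qed
  from bchoice[OF this] obtain p where p: "\<forall>i\<in>I. snd (p i) \<in> M \<and>
      (\<forall>j\<in>I. fst (p i) + snd (p i) j \<le> y j) \<and> fst (p i) + snd (p i) i = y i" ..
  define a x where "a i = fst (p i)" and "x i = snd (p i)" for i
  have ax: "\<And>i. i \<in> I \<Longrightarrow> x i \<in> M"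
    "\<And>i j. i \<in> I \<Longrightarrow> j \<in> I \<Longrightarrow> a i + x i j \<le> y j" "\<And>i. i \<in> I \<Longrightarrow> a i + x i i = y i"
    using p by (auto simp: a_def x_def)
  obtain e where e: "bij_betw e {..<card I} I"
    using ex_bij_betw_nat_finite[OF assms(1)] atLeast0LessThan by metis
  have eI: "e j \<in> I" if "j < card I" for j using e that by (auto simp: bij_betw_def)
  have "y = (\<lambda>i\<in>I. MAX j\<in>{..<card I}. a (e j) + x (e j) i)"
  proof (rule extensionalityI[of _ I])
    fix i assume i: "i \<in> I"
    then obtain j where j: "j < card I" "e j = i" using e by (force simp: bij_betw_def)
    have "(MAX j\<in>{..<card I}. a (e j) + x (e j) i) = y i"
    proof (rule Max_eqI)
      show "y i \<in> (\<lambda>j. a (e j) + x (e j) i) ` {..<card I}"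
        using ax(3)[OF i] j by (intro image_eqI[of _ _ j]) auto
      fix z assume "z \<in> (\<lambda>j. a (e j) + x (e j) i) ` {..<card I}"
      then obtain j' where "j' < card I" "z = a (e j') + x (e j') i" by auto
      then show "z \<le> y i" using ax(2)[OF eI i] by simp
    qed simp
    with i show "y i = (\<lambda>i\<in>I. MAX j\<in>{..<card I}. a (e j) + x (e j) i) i" by simp
  qed (use assms(3) in \<open>simp_all add: PiE_def\<close>)
  moreover have "card I > 0" using assms by (simp add: card_gt_0_iff)
  ultimately show ?thesis
    unfolding tcone_def
    by (intro CollectI exI[of _ "card I"] exI[of _ "\<lambda>j. a (e j)"] exI[of _ "\<lambda>j. x (e j)"])
      (simp add: ax(1) eI)
qed

text \<open>Bolzano-Weierstrass, one coordinate at a time: refining a subsequence keeps the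
  convergence already achieved.\<close>

lemma convergent_subsequence_finite:
  fixes f :: "nat \<Rightarrow> 'i \<Rightarrow> real"
  assumes "finite I" "\<And>m i. i \<in> I \<Longrightarrow> \<bar>f m i\<bar> \<le> B"
  shows "\<exists>r::nat \<Rightarrow> nat. strict_mono r \<and> (\<forall>i\<in>I. convergent (\<lambda>m. f (r m) i))"
  using assms
proof (induction I rule: finite_induct)
  case empty
  then show ?case using strict_mono_id by auto
next
  case (insert i I)
  then obtain r :: "nat \<Rightarrow> nat" where r: "strict_mono r" "\<forall>i\<in>I. convergent (\<lambda>m. f (r m) i)" by auto
  have "bounded (range (\<lambda>m. f (r m) i))"
    using insert.prems by (auto simp: bounded_iff)
  then obtain l s where s: "strict_mono s" "((\<lambda>m. f (r m) i) \<circ> s) \<longlonglongrightarrow> l"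
    using bounded_imp_convergent_subsequence by blast
  have "convergent (\<lambda>m. f ((r \<circ> s) m) j)" if "j \<in> I" for j
    using r(2) that convergent_subseq_convergent[OF _ s(1), of "\<lambda>m. f (r m) j"] by (auto simp: o_def)
  moreover have "convergent (\<lambda>m. f ((r \<circ> s) m) i)"
    using s(2) by (auto simp: o_def convergent_def)
  ultimately show ?case
    using strict_mono_o[OF r(1) s(1)] by blast
qed

section \<open>Power sums\<close>

lemma power_sum_even_nonneg: "even k \<Longrightarrow> power_sum k n x \<ge> 0"
  by (auto simp: power_sum_def intro!: sum_nonneg zero_le_even_power)

lemma power_sum_even_pos_iff:
  assumes "even k" "k > 0"
  shows "power_sum k n x > 0 \<longleftrightarrow> (\<exists>i<n. x i \<noteq> 0)"
proof -
  have "power_sum k n x = 0 \<longleftrightarrow> (\<forall>i<n. x i = 0)"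
    unfolding power_sum_def using assms by (subst sum_nonneg_eq_0_iff) auto
  then show ?thesis using power_sum_even_nonneg[OF assms(1), of n x] by auto
qed

lemma power_sum_scale: "power_sum k n (\<lambda>i. c * x i) = c ^ k * power_sum k n x"
  by (simp add: power_sum_def power_mult_distrib sum_distrib_left)

lemma power_sum_pad:
  "k > 0 \<Longrightarrow> power_sum k (n + m) (\<lambda>i. if i < n then x i else 0) = power_sum k n x"
  by (induction m) (auto simp: power_sum_def)

text \<open>The index \<open>i = a * n + b\<close> enumerates the coordinates
  \<open>x a * y b\<close> of the tensor product, whose power sums factor.\<close>

lemma power_sum_tensor:
  "power_sum k (m * n) (\<lambda>i. x (i div n) * y (i mod n)) = power_sum k m x * power_sum k n y"
proof (induction m)
  case (Suc m)
  \<comment> \<open>The last block of length \<open>n\<close> carries the coordinates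
    \<open>x m * y b\<close>.\<close>
  have "{..<Suc m * n} = {..<m * n} \<union> (\<lambda>b. m * n + b) ` {..<n}"
  proof (intro equalityI subsetI)
    fix i assume "i \<in> {..<Suc m * n}"
    then show "i \<in> {..<m * n} \<union> (\<lambda>b. m * n + b) ` {..<n}"
      by (cases "i < m * n") (auto intro!: image_eqI[of _ _ "i - m * n"])
  qed auto
  then have "power_sum k (Suc m * n) (\<lambda>i. x (i div n) * y (i mod n)) =
      power_sum k (m * n) (\<lambda>i. x (i div n) * y (i mod n)) + (\<Sum>b<n. (x m * y b) ^ k)"
    unfolding power_sum_def by (simp, subst sum.union_disjoint) (auto simp: sum.reindex)
  then show ?case
    using Suc by (simp add: power_sum_def power_mult_distrib sum_distrib_left distrib_right sum.distrib)
qed (simp add: power_sum_def)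

text \<open>Iterated tensor products; for \<open>N = 0\<close> the single coordinate 1 has all its
  power sums equal to 1.\<close>

lemma power_sum_tensor_power: "\<exists>n' x'. \<forall>k. power_sum k n' x' = power_sum k n x ^ N"
proof (induction N)
  case 0
  show ?case by (rule exI[of _ 1], rule exI[of _ "\<lambda>_. 1"]) (simp add: power_sum_def)
next
  case (Suc N)
  then obtain n' x' where "\<forall>k. power_sum k n' x' = power_sum k n x ^ N" by blast
  then show ?case using power_sum_tensor[of _ n n' x x'] by (metis power_Suc)
qed

text \<open>Cauchy-Schwarz for the vectors with entries \<open>x i ^ k\<close> and
  \<open>x i ^ (k + 2)\<close>.\<close>

lemma power_sum_log_convex:
  "(power_sum (2 * (k + 1)) n x)\<^sup>2 \<le> power_sum (2 * k) n x * power_sum (2 * (k + 2)) n x"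
proof -
  have "(\<Sum>i<n. x i ^ k * x i ^ (k + 2))\<^sup>2 \<le> (\<Sum>i<n. (x i ^ k)\<^sup>2) * (\<Sum>i<n. (x i ^ (k + 2))\<^sup>2)"
    by (rule Cauchy_Schwarz_ineq_sum)
  moreover have e: "k + (k + 2) = 2 * (k + 1)" by simp
  have "x i ^ k * x i ^ (k + 2) = x i ^ (2 * (k + 1))"
    "(x i ^ k)\<^sup>2 = x i ^ (2 * k)" "(x i ^ (k + 2))\<^sup>2 = x i ^ (2 * (k + 2))" for i
    by (simp_all only: power_add[symmetric] power_mult[symmetric] mult.commute e)
  ultimately show ?thesis by (simp only: power_sum_def)
qed

text \<open>The normalization forces \<open>(x i)\<^sup>2 \<le> 1\<close> for every coordinate, so
  higher even powers are smaller termwise.\<close>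

lemma power_sum_mono:
  assumes "power_sum 2 n x = 1" "1 \<le> j" "j \<le> k"
  shows "power_sum (2 * k) n x \<le> power_sum (2 * j) n x"
  unfolding power_sum_def
proof (rule sum_mono)
  fix i assume "i \<in> {..<n}"
  then have "(x i)\<^sup>2 \<le> power_sum 2 n x"
    unfolding power_sum_def by (intro member_le_sum) auto
  then show "x i ^ (2 * k) \<le> x i ^ (2 * j)"
    unfolding power_mult using assms by (intro power_decreasing) auto
qed

text \<open>By log-convexity the ratios of consecutive even power sums do not decrease, and the
  first ratio is \<open>power_sum 4 n x\<close>. The product of the first \<open>k\<close> ratios
  gives the bound.\<close>

lemma power_sum_lower:
  assumes "power_sum 2 n x = 1"
  shows "power_sum 4 n x ^ k \<le> power_sum (2 * (k + 1)) n x"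
proof -
  define q where "q j = power_sum (2 * (j + 1)) n x" for j
  have "\<exists>i<n. x i \<noteq> 0" using assms power_sum_even_pos_iff[of 2 n x] by auto
  then have pos: "q j > 0" for j by (simp add: q_def power_sum_even_pos_iff)
  have conv: "(q (Suc j))\<^sup>2 \<le> q j * q (Suc (Suc j))" for j
    using power_sum_log_convex[of "j + 1" n x] by (simp add: q_def)
  have q0: "q 0 = 1" "q 1 = power_sum 4 n x" using assms by (simp_all add: q_def)
  have step: "q 1 * q j \<le> q (Suc j)" for j
  proof (induction j)
    case (Suc j)
    \<comment> \<open>The ratio bound is carried on without division; the positive factor
      \<open>q j\<close> is cancelled at the end.\<close>
    have "q j * (q 1 * q (Suc j)) \<le> q (Suc j) * q (Suc j)"
      using Suc mult_right_mono[OF Suc less_imp_le[OF pos[of "Suc j"]]] by (simp add: ac_simps)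
    also have "\<dots> \<le> q j * q (Suc (Suc j))" using conv[of j] by (simp add: power2_eq_square)
    finally show ?case using pos[of j] by simp
  qed (simp add: q0)
  have "q 1 ^ k \<le> q k"
  proof (induction k)
    case (Suc k)
    have "q 1 ^ Suc k \<le> q 1 * q k" using Suc pos[of 1] by (simp add: mult_left_mono)
    then show ?case using step[of k] by simp
  qed (simp add: q0)
  then show ?thesis by (simp add: q0 q_def)
qed

section \<open>Products of power sums over partitions\<close>

lemma prod_mset_pos: "\<forall>k\<in>#\<mu>. f k > (0::real) \<Longrightarrow> (\<Prod>k\<in>#\<mu>. f k) > 0"
  by (induction \<mu>) auto

lemma ln_prod_mset: "\<forall>k\<in>#\<mu>. f k > (0::real) \<Longrightarrow> ln (\<Prod>k\<in>#\<mu>. f k) = (\<Sum>k\<in>#\<mu>. ln (f k))"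
  by (induction \<mu>) (simp_all add: ln_mult_pos prod_mset_pos)

lemma sum_mset_divide: "(\<Sum>k\<in>#\<mu>. f k) / c = (\<Sum>k\<in>#\<mu>. f k / (c::real))"
  by (induction \<mu>) (auto simp: add_divide_distrib)

lemma sum_mset_nonpos_le:
  assumes "k \<in># \<mu>" "\<forall>j\<in>#\<mu>. f j \<le> (0::real)"
  shows "(\<Sum>j\<in>#\<mu>. f j) \<le> f k"
proof -
  obtain \<mu>' where \<mu>': "\<mu> = add_mset k \<mu>'" using assms(1) by (meson mset_add)
  have "(\<Sum>j\<in>#\<mu>'. f j) \<le> 0"
    using assms(2) unfolding \<mu>' by (induction \<mu>') auto
  then show ?thesis by (simp add: \<mu>')
qed

lemma sum_mset_close:
  assumes "\<forall>k\<in>#\<mu>. \<bar>f k - g k\<bar> \<le> (e::real)"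
  shows "\<bar>(\<Sum>k\<in>#\<mu>. f k) - (\<Sum>k\<in>#\<mu>. g k)\<bar> \<le> real (size \<mu>) * e"
  using assms
proof (induction \<mu>)
  case (add k \<mu>)
  then have "\<bar>f k - g k\<bar> \<le> e" "\<bar>(\<Sum>k\<in>#\<mu>. f k) - (\<Sum>k\<in>#\<mu>. g k)\<bar> \<le> real (size \<mu>) * e" by simp_all
  then show ?case by (simp add: distrib_right)
qed simp

lemma tendsto_sum_mset:
  "\<forall>k\<in>#\<mu>. ((\<lambda>m. f m k) \<longlongrightarrow> (g k :: real)) F \<Longrightarrow> ((\<lambda>m. \<Sum>k\<in>#\<mu>. f m k) \<longlongrightarrow> (\<Sum>k\<in>#\<mu>. g k)) F"
  by (induction \<mu>) (simp_all add: tendsto_add)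

lemma even_partitionsD:
  assumes "\<mu> \<in> even_partitions (2 * d)" "k \<in># \<mu>"
  shows "even k" "k > 0" "k div 2 \<in> {1..d}" "2 * (k div 2) = k"
proof -
  show e: "even k" and p: "k > 0"
    using assms by (auto simp: even_partitions_def partitions_def intro: gr0I)
  obtain \<mu>' where "\<mu> = add_mset k \<mu>'" using assms(2) by (meson mset_add)
  then have "k \<le> 2 * d" using assms(1) by (auto simp: even_partitions_def partitions_def)
  then show "k div 2 \<in> {1..d}" "2 * (k div 2) = k" using e p by auto
qed

lemma size_le_even_partition:
  assumes "\<mu> \<in> even_partitions (2 * d)"
  shows "size \<mu> \<le> 2 * d"
proof -
  have "0 \<notin># \<nu> \<Longrightarrow> size \<nu> \<le> sum_mset \<nu>" for \<nu> :: "nat multiset"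
    by (induction \<nu>) auto
  from this[of \<mu>] show ?thesis using assms by (auto simp: even_partitions_def partitions_def)
qed

lemma even_partition_nonempty:
  assumes "\<mu> \<in> even_partitions (2 * d)" "d \<ge> 1"
  obtains k where "k \<in># \<mu>"
  using assms by (cases "\<mu> = {#}") (auto simp: even_partitions_def partitions_def)

lemma replicate_in_even_partitions: "replicate_mset d 2 \<in> even_partitions (2 * d)"
  by (auto simp: even_partitions_def partitions_def)

text \<open>At points with \<open>p_2 = 1\<close> the monomial of the first partition is constant
  and carries no information, whereas a part of at least 4 gives control of \<open>p_4\<close>. The
  two cases call for different arguments later.\<close>

lemma even_partition_cases:
  assumes "\<mu> \<in> even_partitions (2 * d)"
  obtains "\<mu> = replicate_mset d 2" | k where "k \<in># \<mu>" "k div 2 \<ge> 2"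
proof (cases "\<forall>k\<in>#\<mu>. k = 2")
  case True
  then have "\<mu> = replicate_mset (size \<mu>) 2"
    by (simp add: set_mset_subset_singletonD subset_eq)
  moreover have "sum_mset \<mu> = 2 * d" using assms by (simp add: even_partitions_def partitions_def)
  moreover have "sum_mset (replicate_mset (size \<mu>) (2::nat)) = 2 * size \<mu>" by simp
  ultimately have "\<mu> = replicate_mset d 2" by simp
  then show ?thesis by (rule that(1))
next
  case False
  then obtain k where "k \<in># \<mu>" "k \<noteq> 2" by blast
  then show ?thesis using even_partitionsD[OF assms, of k] that(2) by (auto elim!: evenE)
qed

lemma power_sum_partition_nonneg:
  assumes "\<mu> \<in> even_partitions (2 * d)"
  shows "power_sum_partition \<mu> n x \<ge> 0"
proof -
  have "\<forall>k\<in>#\<mu>. power_sum k n x \<ge> 0"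
    using even_partitionsD[OF assms] power_sum_even_nonneg by blast
  then show ?thesis
    unfolding power_sum_partition_def by (induction \<mu>) auto
qed

lemma power_sum_partition_scale:
  assumes "\<mu> \<in> even_partitions (2 * d)"
  shows "power_sum_partition \<mu> n (\<lambda>i. c * x i) = c ^ (2 * d) * power_sum_partition \<mu> n x"
proof -
  have "power_sum_partition \<mu> n (\<lambda>i. c * x i) = c ^ sum_mset \<mu> * power_sum_partition \<mu> n x"
    unfolding power_sum_partition_def by (induction \<mu>) (auto simp: power_sum_scale power_add)
  then show ?thesis using assms by (simp add: even_partitions_def partitions_def)
qed

text \<open>Membership in \<open>BP d\<close> only speaks of at least \<open>2 * d\<close>
  variables; padding a point with \<open>2 * d\<close> zeros reaches that range and leaves the power
  sums of positive degree unchanged.\<close>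

lemma BP_nonneg:
  assumes "c \<in> BP d"
  shows "(\<Sum>\<mu>\<in>even_partitions (2 * d). c \<mu> * power_sum_partition \<mu> n x) \<ge> 0"
proof -
  have "power_sum_partition \<mu> (n + 2 * d) (\<lambda>i. if i < n then x i else 0) = power_sum_partition \<mu> n x"
    if "\<mu> \<in> even_partitions (2 * d)" for \<mu>
    unfolding power_sum_partition_def
    by (rule arg_cong[of _ _ prod_mset], rule image_mset_cong)
      (use even_partitionsD[OF that] in \<open>auto simp: power_sum_pad\<close>)
  then have "(\<Sum>\<mu>\<in>even_partitions (2 * d). c \<mu> * power_sum_partition \<mu> n x) =
      (\<Sum>\<mu>\<in>even_partitions (2 * d).
        c \<mu> * power_sum_partition \<mu> (n + 2 * d) (\<lambda>i. if i < n then x i else 0))"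
    by simp
  also have "\<dots> \<ge> 0" using assms by (auto simp: BP_def)
  finally show ?thesis .
qed

section \<open>The power sum region\<close>

text \<open>Taking the closure does not change the limit set: a positive point of the closure is
  approximated by actual power sum vectors up to a bounded factor in each coordinate, which is
  harmless after taking logarithms and dividing by \<open>T\<close>.\<close>

lemma trop_region_iff:
  assumes "d \<ge> 1"
  shows "y \<in> trop {1..d} (even_power_sum_region d) \<longleftrightarrow> y \<in> {1..d} \<rightarrow>\<^sub>E UNIV \<and>
    (\<forall>\<eta>>0. \<forall>T0. \<exists>T>T0. \<exists>n x. \<forall>k\<in>{1..d}.
      power_sum (2 * k) n x > 0 \<and> \<bar>ln (power_sum (2 * k) n x) / T - y k\<bar> < \<eta>)"
proof -
  let ?U = "\<Union>n\<in>{1..}. range (\<lambda>x::nat \<Rightarrow> real. \<lambda>k\<in>{1..d}. power_sum (2 * k) n x)"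
  have from_points: "(\<exists>T>T0. \<exists>u\<in>even_power_sum_region d. \<forall>k\<in>{1..d}. u k > 0 \<and> \<bar>ln (u k) / T - y k\<bar> < \<eta>)"
    if R: "\<exists>T>T0. \<exists>n x. \<forall>k\<in>{1..d}.
      power_sum (2 * k) n x > 0 \<and> \<bar>ln (power_sum (2 * k) n x) / T - y k\<bar> < \<eta>" for \<eta> T0
  proof -
    obtain T n x where T: "T > T0" and x: "\<And>k. k \<in> {1..d} \<Longrightarrow>
      power_sum (2 * k) n x > 0 \<and> \<bar>ln (power_sum (2 * k) n x) / T - y k\<bar> < \<eta>"
      using R by blast
    have "power_sum 2 n x > 0" using x[of 1] assms by simp
    then have "n \<ge> 1" by (cases n) (auto simp: power_sum_def)
    then have "(\<lambda>k\<in>{1..d}. power_sum (2 * k) n x) \<in> ?U" by blast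
    then have "(\<lambda>k\<in>{1..d}. power_sum (2 * k) n x) \<in> even_power_sum_region d"
      unfolding even_power_sum_region_def by (rule subsetD[OF closure_subset])
    with T show ?thesis
      by (intro exI[of _ T] conjI bexI[of _ "\<lambda>k\<in>{1..d}. power_sum (2 * k) n x"])
        (simp_all add: x)
  qed
  have to_points: "\<exists>T>T0. \<exists>n x. \<forall>k\<in>{1..d}.
      power_sum (2 * k) n x > 0 \<and> \<bar>ln (power_sum (2 * k) n x) / T - y k\<bar> < \<eta>"
    if R: "\<forall>\<eta>>0. \<forall>T0. \<exists>T>T0. \<exists>u\<in>even_power_sum_region d.
      \<forall>k\<in>{1..d}. u k > 0 \<and> \<bar>ln (u k) / T - y k\<bar> < \<eta>" and "\<eta> > 0" for \<eta> T0
  proof -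
    \<comment> \<open>One half of \<open>\<eta>\<close> is spent on approximating \<open>y\<close>,
      the other on leaving the closure; \<open>T > 1\<close> ensures that division by
      \<open>T\<close> does not enlarge the latter error.\<close>
    have "\<eta> / 2 > 0" using that by simp
    with R obtain T u where T: "T > max T0 1" and u: "u \<in> closure ?U"
      and uy: "\<And>k. k \<in> {1..d} \<Longrightarrow> u k > 0 \<and> \<bar>ln (u k) / T - y k\<bar> < \<eta> / 2"
      unfolding even_power_sum_region_def by meson
    \<comment> \<open>A multiplicative window around \<open>u k\<close> becomes an additive one
      under \<open>ln\<close>. Coordinates outside \<open>{1..d}\<close> stay free, because an open
      box in the product topology restricts only finitely many of them.\<close>
    define V where "V k = (if k \<in> {1..d} then {u k * exp (- (\<eta> / 2))<..<u k * exp (\<eta> / 2)} else UNIV)" for k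
    have "open (PiE UNIV V)"
    proof (rule open_PiE)
      show "open (V i)" for i by (simp add: V_def)
      show "finite {i. V i \<noteq> UNIV}"
        by (rule finite_subset[of _ "{1..d}"]) (auto simp: V_def)
    qed
    moreover have "u \<in> PiE UNIV V"
      using uy \<open>\<eta> > 0\<close> by (auto simp: V_def PiE_def)
    ultimately obtain v where v: "v \<in> ?U" "v \<in> PiE UNIV V"
      using u open_Int_closure_eq_empty[of "PiE UNIV V" ?U] by blast
    then obtain n x where vx: "v = (\<lambda>k\<in>{1..d}. power_sum (2 * k) n x)" by blast
    have "power_sum (2 * k) n x > 0 \<and> \<bar>ln (power_sum (2 * k) n x) / T - y k\<bar> < \<eta>"
      if k: "k \<in> {1..d}" for k
    proof -
      define p where "p = power_sum (2 * k) n x"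
      have "v k \<in> V k" using v(2) by (rule PiE_mem) simp
      then have "p \<in> V k" using k unfolding vx p_def by simp
      then have p: "u k * exp (- (\<eta> / 2)) < p" "p < u k * exp (\<eta> / 2)"
        using k by (auto simp: V_def)
      have uk: "u k > 0" using uy[OF k] by simp
      have p0: "p > 0"
        by (rule less_trans[OF mult_pos_pos[OF uk exp_gt_zero] p(1)])
      have "ln (u k * exp (- (\<eta> / 2))) < ln p"
        by (rule iffD2[OF ln_less_cancel_iff]) (use p p0 uk in auto)
      moreover have "ln p < ln (u k * exp (\<eta> / 2))"
        by (rule iffD2[OF ln_less_cancel_iff]) (use p p0 uk in auto)
      ultimately have "ln p - ln (u k) < \<eta> / 2" "- (ln p - ln (u k)) < \<eta> / 2"
        using uk by (simp_all add: ln_mult_pos)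
      then have "\<bar>ln p - ln (u k)\<bar> < \<eta> / 2" by (simp only: abs_less_iff)
      moreover have "\<bar>ln p / T - ln (u k) / T\<bar> = \<bar>ln p - ln (u k)\<bar> / T"
        using T by (simp add: diff_divide_distrib[symmetric])
      moreover have "\<bar>ln p - ln (u k)\<bar> / T \<le> \<bar>ln p - ln (u k)\<bar>"
        using T mult_left_mono[of 1 T "\<bar>ln p - ln (u k)\<bar>"] by (simp add: divide_le_eq)
      ultimately show ?thesis using uy[OF k] p0 unfolding p_def[symmetric] by linarith
    qed
    then show ?thesis using T by (intro exI[of _ T] conjI exI[of _ n] exI[of _ x]) simp_all
  qed
  show ?thesis
    unfolding trop_iff[OF finite_atLeastAtMost]
    by (intro conj_cong refl iffI allI impI) (rule to_points, assumption+, rule from_points, simp)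
qed

text \<open>
  The values of the power sums are closed under products, so every scale \<open>T0\<close> at which \<open>y\<close> is
  approximated yields approximations at all larger scales \<open>T\<close>, by raising to the power
  \<open>\<lfloor>T / T0\<rfloor>\<close>. Hence the limit set obtained along some sequence of bases is a genuine limit.
\<close>
lemma trop_region_eventually:
  assumes "d \<ge> 1" "y \<in> trop {1..d} (even_power_sum_region d)" "\<eta> > 0"
  shows "\<forall>\<^sub>F T in at_top. \<exists>n x. \<forall>k\<in>{1..d}.
    power_sum (2 * k) n x > 0 \<and> \<bar>ln (power_sum (2 * k) n x) / T - y k\<bar> < \<eta>"
proof -
  have "\<eta> / 2 > 0" using assms(3) by simp
  with assms(2) obtain T0 n x where T0: "T0 > 0" and x: "\<And>k. k \<in> {1..d} \<Longrightarrow>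
      power_sum (2 * k) n x > 0 \<and> \<bar>ln (power_sum (2 * k) n x) / T0 - y k\<bar> < \<eta> / 2"
    unfolding trop_region_iff[OF assms(1)] by meson
  define L where "L k = ln (power_sum (2 * k) n x)" for k
  have "\<forall>\<^sub>F T in at_top. \<bar>L k\<bar> / T < \<eta> / 2" for k
  proof -
    have "((\<lambda>T. \<bar>L k\<bar> / T) \<longlongrightarrow> 0) at_top"
      by (rule tendsto_divide_0[OF tendsto_const]) (rule filterlim_at_top_imp_at_infinity[OF filterlim_ident])
    then show ?thesis by (rule order_tendstoD) (use assms(3) in simp)
  qed
  then have "\<forall>\<^sub>F T in at_top. \<forall>k\<in>{1..d}. \<bar>L k\<bar> / T < \<eta> / 2"
    by (intro eventually_ball_finite) auto
  then show ?thesis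
    using eventually_gt_at_top[of 0]
  proof eventually_elim
    case (elim T)
    define N where "N = nat \<lfloor>T / T0\<rfloor>"
    obtain n' x' where x': "\<And>k. power_sum k n' x' = power_sum k n x ^ N"
      using power_sum_tensor_power by blast
    have "T / T0 > 0" using elim T0 by simp
    then have "real N \<le> T / T0" "T / T0 < real N + 1"
      unfolding N_def by linarith+
    then have N: "\<bar>real N - T / T0\<bar> \<le> 1" by linarith
    have "power_sum (2 * k) n' x' > 0 \<and> \<bar>ln (power_sum (2 * k) n' x') / T - y k\<bar> < \<eta>"
      if k: "k \<in> {1..d}" for k
    proof -
      have ln: "ln (power_sum (2 * k) n' x') = real N * L k"
        using x[OF k] by (simp add: x' L_def ln_realpow)
      \<comment> \<open>Rounding \<open>T / T0\<close> down to \<open>N\<close> costs at most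
        \<open>\<bar>L k\<bar> / T\<close>, which is below \<open>\<eta> / 2\<close> for large
        \<open>T\<close>.\<close>
      have "real N * L k / T - L k / T0 = (real N - T / T0) * (L k / T)"
        using elim T0 by (simp add: field_simps)
      then have "\<bar>real N * L k / T - L k / T0\<bar> = \<bar>real N - T / T0\<bar> * (\<bar>L k\<bar> / T)"
        using elim by (simp add: abs_mult)
      also have "\<dots> \<le> 1 * (\<bar>L k\<bar> / T)"
        by (rule mult_right_mono[OF N]) (use elim in simp)
      also have "\<dots> < \<eta> / 2" using elim k by simp
      finally have "\<bar>real N * L k / T - L k / T0\<bar> < \<eta> / 2" .
      moreover have "\<bar>L k / T0 - y k\<bar> < \<eta> / 2" using x[OF k] by (simp add: L_def)
      ultimately have "\<bar>(real N * L k / T - L k / T0) + (L k / T0 - y k)\<bar> < \<eta> / 2 + \<eta> / 2"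
        by (intro le_less_trans[OF abs_triangle_ineq] add_strict_mono)
      then have "\<bar>real N * L k / T - y k\<bar> < \<eta>" by simp
      then show ?thesis using x[OF k] unfolding ln by (simp add: x')
    qed
    then show ?case by blast
  qed
qed

text \<open>For \<open>n\<close> coordinates equal to \<open>1 / sqrt n\<close> the power sum of
  degree \<open>2 * k\<close> is \<open>n\<close> to the power \<open>1 - k\<close>. The scale
  \<open>T = ln n / M\<close> turns its logarithm into \<open>- (k - 1) * M\<close>.\<close>

lemma uniform_in_trop_region:
  assumes "d \<ge> 1" "M > 0"
  shows "(\<lambda>k\<in>{1..d}. - (real (k - 1) * M)) \<in> trop {1..d} (even_power_sum_region d)"
  unfolding trop_region_iff[OF assms(1)]
proof (intro conjI allI impI)
  fix \<eta> T0 :: real assume "\<eta> > 0"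
  obtain n :: nat where n: "real n > max 1 (exp (T0 * M))" using reals_Archimedean2 by blast
  define T where "T = ln (real n) / M"
  have "ln (exp (T0 * M)) < ln (real n)" by (rule iffD2[OF ln_less_cancel_iff]) (use n in auto)
  then have "T > T0" using assms(2) by (simp add: T_def less_divide_eq)
  have "ln (real n) > 0" using n by simp
  define x where "x = (\<lambda>i::nat. 1 / sqrt (real n))"
  have ps: "power_sum (2 * k) n x = real n * (1 / real n) ^ k" for k
    by (simp add: x_def power_sum_def power_mult power_divide)
  have "ln (power_sum (2 * k) n x) / T = - (real (k - 1) * M)" if "k \<in> {1..d}" for k
  proof -
    have "ln (power_sum (2 * k) n x) = ln (real n) + real k * ln (1 / real n)"
      unfolding ps using n by (subst ln_mult_pos) (auto simp: ln_realpow)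
    also have "\<dots> = - (real (k - 1) * ln (real n))"
      using n that by (simp add: ln_div of_nat_diff algebra_simps)
    finally show ?thesis
      using \<open>ln (real n) > 0\<close> assms(2) by (simp add: T_def)
  qed
  moreover have "power_sum (2 * k) n x > 0" for k using n by (simp add: ps)
  ultimately show "\<exists>T>T0. \<exists>n x. \<forall>k\<in>{1..d}. power_sum (2 * k) n x > 0 \<and>
      \<bar>ln (power_sum (2 * k) n x) / T - (\<lambda>k\<in>{1..d}. - (real (k - 1) * M)) k\<bar> < \<eta>"
    using \<open>T > T0\<close> \<open>\<eta> > 0\<close> by (intro exI[of _ T] conjI exI[of _ n] exI[of _ x]) auto
qed simp

section \<open>The dual cone\<close>

text \<open>
  If the conclusion failed at every point, then
  \<open>(\<Sum>\<mu>. \<phi>\<^sub>\<nu> / \<phi>\<^sub>\<mu> \<cdot> p\<^sub>\<mu>) - C \<cdot> p\<^sub>\<nu>\<close> with \<open>C\<close> larger than the number of partitions would be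
  nonnegative, although its pairing with \<open>\<phi>\<close> is negative.
\<close>
lemma BP_dual_dominating_point:
  assumes "d \<ge> 1" "\<phi> \<in> BP_dual d" "\<And>\<mu>. \<mu> \<in> even_partitions (2 * d) \<Longrightarrow> \<phi> \<mu> > 0"
    and l: "\<nu> \<in> even_partitions (2 * d)"
  obtains n x where "power_sum 2 n x = 1" "\<And>k. k > 0 \<Longrightarrow> power_sum (2 * k) n x > 0"
    "\<And>\<mu>. \<mu> \<in> even_partitions (2 * d) \<Longrightarrow> \<phi> \<nu> * power_sum_partition \<mu> n x \<le>
      (real (card (even_partitions (2 * d))) + 1) * (\<phi> \<mu> * power_sum_partition \<nu> n x)"
proof -
  let ?E = "even_partitions (2 * d)"
  let ?P = power_sum_partition
  \<comment> \<open>The pairing of \<open>c\<close> with \<open>\<phi>\<close> is then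
    \<open>card ?E * \<phi> \<nu> - C * \<phi> \<nu> = - \<phi> \<nu>\<close>.\<close>
  define C where "C = real (card ?E) + 1"
  define c where "c = (\<lambda>\<mu>\<in>?E. \<phi> \<nu> / \<phi> \<mu> - (if \<mu> = \<nu> then C else 0))"
  have c_sum: "(\<Sum>\<mu>\<in>?E. c \<mu> * f \<mu>) = (\<Sum>\<mu>\<in>?E. \<phi> \<nu> / \<phi> \<mu> * f \<mu>) - C * f \<nu>" for f
  proof -
    have "(\<Sum>\<mu>\<in>?E. c \<mu> * f \<mu>) = (\<Sum>\<mu>\<in>?E. \<phi> \<nu> / \<phi> \<mu> * f \<mu> - (if \<mu> = \<nu> then C * f \<mu> else 0))"
      by (rule sum.cong) (auto simp: c_def left_diff_distrib)
    then show ?thesis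
      using l by (simp add: sum_subtractf finite_even_partitions)
  qed
  have "(\<Sum>\<mu>\<in>?E. c \<mu> * \<phi> \<mu>) = (\<Sum>\<mu>\<in>?E. \<phi> \<nu>) - C * \<phi> \<nu>"
    unfolding c_sum by (intro arg_cong2[of _ _ _ _ minus] sum.cong refl)
      (simp add: assms(3) less_imp_neq[symmetric])
  also have "\<dots> = - \<phi> \<nu>" by (simp add: C_def algebra_simps)
  also have "\<dots> < 0" using assms(3)[OF l] by simp
  finally have "c \<notin> BP d" using assms(2) by (auto simp: BP_dual_def not_le[symmetric])
  moreover have "c \<in> ?E \<rightarrow>\<^sub>E UNIV" by (simp add: c_def)
  ultimately obtain n x where "(\<Sum>\<mu>\<in>?E. c \<mu> * ?P \<mu> n x) < 0"
    by (auto simp: BP_def not_le)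
  then have neg: "(\<Sum>\<mu>\<in>?E. \<phi> \<nu> / \<phi> \<mu> * ?P \<mu> n x) < C * ?P \<nu> n x"
    by (simp add: c_sum)
  have le: "\<phi> \<nu> * ?P \<mu> n x \<le> C * (\<phi> \<mu> * ?P \<nu> n x)" if "\<mu> \<in> ?E" for \<mu>
  proof -
    \<comment> \<open>All summands are nonnegative, so the bound on the sum holds for each of
      them.\<close>
    have "\<phi> \<nu> / \<phi> \<mu> * ?P \<mu> n x \<le> (\<Sum>\<mu>\<in>?E. \<phi> \<nu> / \<phi> \<mu> * ?P \<mu> n x)"
    proof (rule member_le_sum[OF that _ finite_even_partitions])
      fix \<kappa> assume "\<kappa> \<in> ?E - {\<mu>}"
      then show "0 \<le> \<phi> \<nu> / \<phi> \<kappa> * ?P \<kappa> n x"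
        using assms(3)[of \<kappa>, THEN less_imp_le] assms(3)[OF l, THEN less_imp_le]
          power_sum_partition_nonneg[of \<kappa> d n x]
        by (intro mult_nonneg_nonneg divide_nonneg_nonneg) simp_all
    qed
    then have "\<phi> \<nu> / \<phi> \<mu> * ?P \<mu> n x \<le> C * ?P \<nu> n x" using neg by linarith
    then show ?thesis
      using assms(3)[OF that] by (simp add: field_simps)
  qed
  \<comment> \<open>At the origin both sides of the strict inequality \<open>neg\<close> would
    vanish.\<close>
  have "\<exists>i<n. x i \<noteq> 0"
  proof (rule ccontr)
    assume "\<not> (\<exists>i<n. x i \<noteq> 0)"
    then have z: "power_sum k n x = 0" if "k > 0" for k using that by (simp add: power_sum_def)
    have "?P \<mu> n x = 0" if mu: "\<mu> \<in> ?E" for \<mu>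
    proof -
      obtain k where "k \<in># \<mu>" using even_partition_nonempty[OF mu assms(1)] .
      then show ?thesis
        using z even_partitionsD(2)[OF mu] unfolding power_sum_partition_def
        by (auto simp: prod_mset_zero_iff image_iff intro!: bexI[of _ k])
    qed
    then show False using neg l by simp
  qed
  then have pos: "power_sum (2 * k) n x > 0" if "k > 0" for k
    using that by (simp add: power_sum_even_pos_iff)
  \<comment> \<open>Both sides of \<open>le\<close> are homogeneous of degree \<open>2 * d\<close>,
    so the point can be rescaled to satisfy \<open>p_2 = 1\<close>.\<close>
  define s where "s = 1 / sqrt (power_sum 2 n x)"
  have s: "s > 0" "s\<^sup>2 * power_sum 2 n x = 1"
    using pos[of 1] by (simp_all add: s_def power_divide)
  show thesis
  proof (rule that[of n "\<lambda>i. s * x i"])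
    show "power_sum 2 n (\<lambda>i. s * x i) = 1" using s by (simp add: power_sum_scale)
    show "power_sum (2 * k) n (\<lambda>i. s * x i) > 0" if "k > 0" for k
      using s pos[OF that] by (simp add: power_sum_scale)
    show "\<phi> \<nu> * ?P \<mu> n (\<lambda>i. s * x i) \<le> (real (card ?E) + 1) * (\<phi> \<mu> * ?P \<nu> n (\<lambda>i. s * x i))"
      if "\<mu> \<in> ?E" for \<mu>
      using mult_left_mono[OF le[OF that], of "s ^ (2 * d)"] s(1)
      by (simp add: power_sum_partition_scale[OF that] power_sum_partition_scale[OF l] C_def ac_simps)
  qed
qed

section \<open>Comparison of the tropicalized dual cone with tropical combinations\<close>

lemma ln_power_sum_partition:
  assumes "\<mu> \<in> even_partitions (2 * d)" "\<And>k. k \<in> {1..d} \<Longrightarrow> power_sum (2 * k) n x > 0"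
  shows "power_sum_partition \<mu> n x > 0"
    and "ln (power_sum_partition \<mu> n x) / T = (\<Sum>k\<in>#\<mu>. ln (power_sum (2 * (k div 2)) n x) / T)"
proof -
  have *: "power_sum k n x > 0" "2 * (k div 2) = k" if "k \<in># \<mu>" for k
    using assms(2)[OF even_partitionsD(3)[OF assms(1) that]] even_partitionsD(4)[OF assms(1) that]
    by simp_all
  then show "power_sum_partition \<mu> n x > 0"
    unfolding power_sum_partition_def by (intro prod_mset_pos) blast
  have "ln (power_sum_partition \<mu> n x) = (\<Sum>k\<in>#\<mu>. ln (power_sum k n x))"
    unfolding power_sum_partition_def using * by (intro ln_prod_mset) blast
  also have "\<dots> = (\<Sum>k\<in>#\<mu>. ln (power_sum (2 * (k div 2)) n x))"
    by (rule arg_cong[of _ _ sum_mset], rule image_mset_cong) (simp only: *)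
  finally show "ln (power_sum_partition \<mu> n x) / T =
      (\<Sum>k\<in>#\<mu>. ln (power_sum (2 * (k div 2)) n x) / T)"
    by (simp only: sum_mset_divide)
qed

text \<open>This is the input for \<open>tcone_of_pointwise\<close>. If all parts of
  \<open>\<nu>\<close> are 2, an explicit steep point \<open>w\<close> works. Otherwise
  \<open>w\<close> is a limit of rescaled logarithms of dominating points, bounded because some part
  of \<open>\<nu>\<close> is at least 4.\<close>

lemma trop_BP_dual_pointwise:
  assumes d: "d \<ge> 1" and y: "y \<in> trop (even_partitions (2 * d)) (BP_dual d)"
    and \<nu>: "\<nu> \<in> even_partitions (2 * d)"
  shows "\<exists>a. \<exists>w\<in>trop {1..d} (even_power_sum_region d).
    (\<forall>\<mu>\<in>even_partitions (2 * d). a + (\<Sum>k\<in>#\<mu>. w (k div 2)) \<le> y \<mu>) \<and>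
    a + (\<Sum>k\<in>#\<nu>. w (k div 2)) = y \<nu>"
  using even_partition_cases[OF \<nu>]
proof cases
  case 1
  let ?E = "even_partitions (2 * d)"
  \<comment> \<open>\<open>M\<close> bounds every gap \<open>y \<nu> - y \<mu>\<close>; the summand
    1 makes it positive.\<close>
  define M where "M = 1 + (\<Sum>\<mu>\<in>?E. \<bar>y \<nu> - y \<mu>\<bar>)"
  have M: "y \<nu> - y \<mu> \<le> M" if "\<mu> \<in> ?E" for \<mu>
    using member_le_sum[OF that, of "\<lambda>\<mu>. \<bar>y \<nu> - y \<mu>\<bar>"] finite_even_partitions[of "2 * d"]
    unfolding M_def by (simp add: abs_le_iff)
  have "M > 0" unfolding M_def by (intro add_pos_nonneg sum_nonneg) auto
  define w where "w = (\<lambda>k\<in>{1..d}. - (real (k - 1) * M))"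
  have w: "w \<in> trop {1..d} (even_power_sum_region d)"
    unfolding w_def by (rule uniform_in_trop_region[OF d \<open>M > 0\<close>])
  have \<nu>0: "(\<Sum>k\<in>#\<nu>. w (k div 2)) = 0" using 1 d by (simp add: w_def)
  have "y \<nu> + (\<Sum>k\<in>#\<mu>. w (k div 2)) \<le> y \<mu>" if \<mu>: "\<mu> \<in> ?E" for \<mu>
    using even_partition_cases[OF \<mu>]
  proof cases
    case 1
    then have "\<mu> = \<nu>" using \<open>\<nu> = replicate_mset d 2\<close> by simp
    then show ?thesis using \<nu>0 by simp
  next
    case (2 k)
    \<comment> \<open>A single part of at least 4 already contributes at most \<open>- M\<close>,
      and the other parts contribute nothing positive.\<close>
    have "(\<Sum>k\<in>#\<mu>. w (k div 2)) \<le> w (k div 2)"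
      by (rule sum_mset_nonpos_le[OF 2(1)])
        (use even_partitionsD(3)[OF \<mu>] \<open>M > 0\<close> in \<open>auto simp: w_def\<close>)
    also have "\<dots> = - (real (k div 2 - 1) * M)"
      unfolding w_def using even_partitionsD(3)[OF \<mu> 2(1)] by (simp only: restrict_apply if_True)
    also have "\<dots> \<le> - M"
      using mult_right_mono[of 1 "real (k div 2 - 1)" M] 2(2) \<open>M > 0\<close> by simp
    finally show ?thesis using M[OF \<mu>] by linarith
  qed
  with w \<nu>0 show ?thesis by (intro exI[of _ "y \<nu>"] bexI[of _ w]) auto
next
  case (2 k0)
  let ?E = "even_partitions (2 * d)"
  let ?P = power_sum_partition
  define C where "C = real (card ?E) + 1"
  have "C > 0" by (simp add: C_def)
  have "\<exists>T \<phi>. T > real m + 1 \<and> \<phi> \<in> BP_dual d \<and>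
      (\<forall>\<mu>\<in>?E. \<phi> \<mu> > 0 \<and> \<bar>ln (\<phi> \<mu>) / T - y \<mu>\<bar> < 1 / (real m + 1))" for m :: nat
  proof -
    have "1 / (real m + 1) > 0" by simp
    with y show ?thesis unfolding trop_iff[OF finite_even_partitions] by meson
  qed
  then obtain T :: "nat \<Rightarrow> real" and \<phi> where T: "\<And>m. T m > real m + 1"
    and \<phi>: "\<And>m. \<phi> m \<in> BP_dual d" "\<And>m \<mu>. \<mu> \<in> ?E \<Longrightarrow> \<phi> m \<mu> > 0"
      "\<And>m \<mu>. \<mu> \<in> ?E \<Longrightarrow> \<bar>ln (\<phi> m \<mu>) / T m - y \<mu>\<bar> < 1 / (real m + 1)"
    by metis
  have T0: "T m > 0" for m using T[of m] by linarith
  have "\<exists>n x. power_sum 2 n x = 1 \<and> (\<forall>k>0. power_sum (2 * k) n x > 0) \<and>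
      (\<forall>\<mu>\<in>?E. \<phi> m \<nu> * ?P \<mu> n x \<le> C * (\<phi> m \<mu> * ?P \<nu> n x))" for m
    using BP_dual_dominating_point[OF d \<phi>(1) \<phi>(2) \<nu>, of m] unfolding C_def by metis
  then obtain n x where nx: "\<And>m. power_sum 2 (n m) (x m) = 1"
    "\<And>m k. k > 0 \<Longrightarrow> power_sum (2 * k) (n m) (x m) > 0"
    "\<And>m \<mu>. \<mu> \<in> ?E \<Longrightarrow> \<phi> m \<nu> * ?P \<mu> (n m) (x m) \<le> C * (\<phi> m \<mu> * ?P \<nu> (n m) (x m))"
    by metis
  define z where "z m k = ln (power_sum (2 * k) (n m) (x m)) / T m" for m k
  have P_pos: "?P \<mu> (n m) (x m) > 0" if "\<mu> \<in> ?E" for \<mu> m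
    by (rule ln_power_sum_partition(1)[OF that]) (simp add: nx(2))
  have P_z: "ln (?P \<mu> (n m) (x m)) / T m = (\<Sum>k\<in>#\<mu>. z m (k div 2))" if "\<mu> \<in> ?E" for \<mu> m
    unfolding z_def by (rule ln_power_sum_partition(2)[OF that]) (simp add: nx(2))
  \<comment> \<open>The domination inequality after taking logarithms and dividing by
    \<open>T m\<close>. The constant \<open>C\<close> costs at most
    \<open>\<bar>ln C\<bar> / (m + 1)\<close>, and the approximations of \<open>y \<mu>\<close> and
    \<open>y \<nu>\<close> cost \<open>1 / (m + 1)\<close> each.\<close>
  have main: "y \<nu> - y \<mu> + (\<Sum>k\<in>#\<mu>. z m (k div 2)) - (\<Sum>k\<in>#\<nu>. z m (k div 2)) \<le>
      (\<bar>ln C\<bar> + 2) * (1 / (real m + 1))" if \<mu>: "\<mu> \<in> ?E" for \<mu> m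
  proof -
    have "ln (\<phi> m \<nu> * ?P \<mu> (n m) (x m)) \<le> ln (C * (\<phi> m \<mu> * ?P \<nu> (n m) (x m)))"
      using nx(3)[OF \<mu>] by (intro ln_mono) (simp_all add: \<phi>(2) \<nu> P_pos \<mu>)
    then have "ln (\<phi> m \<nu>) + ln (?P \<mu> (n m) (x m)) \<le> ln C + ln (\<phi> m \<mu>) + ln (?P \<nu> (n m) (x m))"
      using \<phi>(2)[OF \<mu>] \<phi>(2)[OF \<nu>] P_pos[OF \<mu>] P_pos[OF \<nu>] \<open>C > 0\<close> by (simp add: ln_mult_pos)
    then have "(ln (\<phi> m \<nu>) + ln (?P \<mu> (n m) (x m))) / T m \<le>
        (ln C + ln (\<phi> m \<mu>) + ln (?P \<nu> (n m) (x m))) / T m"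
      by (rule divide_right_mono) (use T0 in \<open>simp add: less_imp_le\<close>)
    then have "ln (\<phi> m \<nu>) / T m + (\<Sum>k\<in>#\<mu>. z m (k div 2)) \<le>
        ln C / T m + ln (\<phi> m \<mu>) / T m + (\<Sum>k\<in>#\<nu>. z m (k div 2))"
      unfolding add_divide_distrib P_z[OF \<mu>] P_z[OF \<nu>] .
    moreover have "ln C / T m \<le> \<bar>ln C\<bar> * (1 / (real m + 1))"
    proof -
      have "ln C / T m \<le> \<bar>ln C\<bar> / T m" using T0[of m] by (intro divide_right_mono) auto
      also have "\<dots> \<le> \<bar>ln C\<bar> / (real m + 1)" using T[of m] by (intro divide_left_mono) auto
      finally show ?thesis by simp
    qed
    ultimately show ?thesis
      using \<phi>(3)[OF \<mu>, of m] \<phi>(3)[OF \<nu>, of m] unfolding distrib_right by linarith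
  qed
  have z1: "z m 1 = 0" for m by (simp add: z_def nx(1))
  have z_mono: "z m k \<le> z m j" if "1 \<le> j" "j \<le> k" for m j k
    unfolding z_def using power_sum_mono[OF nx(1) that] nx(2)[of k m] T0[of m] that
    by (intro divide_right_mono ln_mono) auto
  have z_nonpos: "z m k \<le> 0" if "1 \<le> k" for m k using z_mono[of 1 k m] z1 that by simp
  \<comment> \<open>\<open>B\<close> comes from \<open>main\<close> at the partition with all parts
    2, whose sum of \<open>z\<close> vanishes. This bounds the sum over \<open>\<nu>\<close> below
    by \<open>- B\<close>, hence also its term at \<open>k0 div 2\<close>, and by monotonicity
    \<open>z m 2\<close>.\<close>
  define B where "B = \<bar>y (replicate_mset d 2) - y \<nu>\<bar> + \<bar>ln C\<bar> + 2"
  have z2: "z m 2 \<ge> - B" for m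
  proof -
    have "y \<nu> - y (replicate_mset d 2) + 0 - (\<Sum>k\<in>#\<nu>. z m (k div 2)) \<le>
        (\<bar>ln C\<bar> + 2) * (1 / (real m + 1))"
      using main[OF replicate_in_even_partitions, of m] z1[of m] by simp
    also have "\<dots> \<le> (\<bar>ln C\<bar> + 2) * 1" by (intro mult_left_mono) auto
    finally have "- B \<le> (\<Sum>k\<in>#\<nu>. z m (k div 2))" 
      using abs_ge_self[of "y (replicate_mset d 2) - y \<nu>"] by (simp add: B_def)
    also have "\<dots> \<le> z m (k0 div 2)"
      by (rule sum_mset_nonpos_le[OF 2(1)])
        (use even_partitionsD(3)[OF \<nu>] z_nonpos in auto)
    also have "\<dots> \<le> z m 2" by (rule z_mono) (use 2(2) in auto)
    finally show ?thesis .
  qed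
  have "B > 0" unfolding B_def by linarith
  \<comment> \<open>Log-convexity gives \<open>z m k \<ge> (k - 1) * z m 2\<close>, so the bound on
    \<open>z m 2\<close> controls every coordinate.\<close>
  have "\<bar>z m k\<bar> \<le> real d * B" if k: "k \<in> {1..d}" for m k
  proof -
    have "power_sum 4 (n m) (x m) ^ (k - 1) \<le> power_sum (2 * k) (n m) (x m)"
    proof -
      have "k - 1 + 1 = k" using k by simp
      then show ?thesis using power_sum_lower[OF nx(1), of m "k - 1"] by (simp only:)
    qed
    then have "ln (power_sum 4 (n m) (x m) ^ (k - 1)) \<le> ln (power_sum (2 * k) (n m) (x m))"
      using nx(2)[of 2 m] by (intro ln_mono) auto
    then have "real (k - 1) * ln (power_sum 4 (n m) (x m)) / T m \<le> z m k"
      unfolding z_def using T0[of m] nx(2)[of 2 m] by (intro divide_right_mono) (auto simp: ln_realpow)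
    then have "real (k - 1) * z m 2 \<le> z m k" by (simp add: z_def)
    moreover have "real (k - 1) * (- z m 2) \<le> real d * B"
      using k z2[of m] z_nonpos[of 2 m] by (intro mult_mono) auto
    ultimately show ?thesis using z_nonpos[of k m] k by simp
  qed
  then obtain r :: "nat \<Rightarrow> nat" where r: "strict_mono r"
    "\<And>k. k \<in> {1..d} \<Longrightarrow> convergent (\<lambda>m. z (r m) k)"
    using convergent_subsequence_finite[of "{1..d}" z "real d * B"] by blast
  define w where "w = (\<lambda>k\<in>{1..d}. lim (\<lambda>m. z (r m) k))"
  have lim: "(\<lambda>m. z (r m) k) \<longlonglongrightarrow> w k" if "k \<in> {1..d}" for k
    using r(2)[OF that] that by (simp add: w_def convergent_LIMSEQ_iff)
  have w: "w \<in> trop {1..d} (even_power_sum_region d)"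
    unfolding trop_region_iff[OF d]
  proof (intro conjI allI impI)
    fix \<eta> T1 :: real assume "\<eta> > 0"
    have "\<forall>\<^sub>F m in sequentially. \<forall>k\<in>{1..d}. \<bar>z (r m) k - w k\<bar> < \<eta>"
      using lim \<open>\<eta> > 0\<close> by (intro eventually_ball_finite) (auto simp: tendsto_iff dist_real_def)
    moreover have "\<forall>\<^sub>F m in sequentially. T (r m) > T1"
    proof (rule eventually_sequentiallyI[of "nat \<lceil>T1\<rceil>"])
      fix m assume "nat \<lceil>T1\<rceil> \<le> m"
      then have "T1 \<le> real m" by linarith
      also have "real m \<le> real (r m)" using seq_suble[OF r(1), of m] by simp
      finally show "T (r m) > T1" using T[of "r m"] by linarith
    qed
    ultimately have "\<forall>\<^sub>F m in sequentially.
        (\<forall>k\<in>{1..d}. \<bar>z (r m) k - w k\<bar> < \<eta>) \<and> T (r m) > T1"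
      by (rule eventually_conj)
    then obtain m where "\<forall>k\<in>{1..d}. \<bar>z (r m) k - w k\<bar> < \<eta>" "T (r m) > T1"
      by (auto dest: eventually_happens)
    then show "\<exists>T>T1. \<exists>n x. \<forall>k\<in>{1..d}.
        power_sum (2 * k) n x > 0 \<and> \<bar>ln (power_sum (2 * k) n x) / T - w k\<bar> < \<eta>"
      using nx(2)[of _ "r m"]
      by (intro exI[of _ "T (r m)"] conjI exI[of _ "n (r m)"] exI[of _ "x (r m)"])
        (auto simp: z_def)
  qed (simp add: w_def)
  have lim_sum: "(\<lambda>m. \<Sum>k\<in>#\<mu>. z (r m) (k div 2)) \<longlonglongrightarrow> (\<Sum>k\<in>#\<mu>. w (k div 2))" if "\<mu> \<in> ?E" for \<mu>
    by (rule tendsto_sum_mset) (use lim even_partitionsD(3)[OF that] in blast)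
  \<comment> \<open>The inequality \<open>main\<close> along the subsequence, in the limit where its
    error term disappears.\<close>
  have le: "y \<nu> - y \<mu> + (\<Sum>k\<in>#\<mu>. w (k div 2)) - (\<Sum>k\<in>#\<nu>. w (k div 2)) \<le> 0" if \<mu>: "\<mu> \<in> ?E" for \<mu>
  proof (rule LIMSEQ_le)
    show "(\<lambda>m. y \<nu> - y \<mu> + (\<Sum>k\<in>#\<mu>. z (r m) (k div 2)) - (\<Sum>k\<in>#\<nu>. z (r m) (k div 2))) \<longlonglongrightarrow>
        y \<nu> - y \<mu> + (\<Sum>k\<in>#\<mu>. w (k div 2)) - (\<Sum>k\<in>#\<nu>. w (k div 2))"
      by (intro tendsto_diff tendsto_add tendsto_const lim_sum \<mu> \<nu>)
    have "(\<lambda>m. (\<bar>ln C\<bar> + 2) * (1 / (real m + 1))) \<longlonglongrightarrow> (\<bar>ln C\<bar> + 2) * 0"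
      using LIMSEQ_inverse_real_of_nat
      by (intro tendsto_mult_left) (simp add: inverse_eq_divide add.commute)
    from LIMSEQ_subseq_LIMSEQ[OF this r(1)]
    show "(\<lambda>m. (\<bar>ln C\<bar> + 2) * (1 / (real (r m) + 1))) \<longlonglongrightarrow> 0" by (simp add: o_def)
    show "\<exists>N. \<forall>m\<ge>N. y \<nu> - y \<mu> + (\<Sum>k\<in>#\<mu>. z (r m) (k div 2)) - (\<Sum>k\<in>#\<nu>. z (r m) (k div 2)) \<le>
        (\<bar>ln C\<bar> + 2) * (1 / (real (r m) + 1))"
      using main[OF \<mu>] by blast
  qed
  define a where "a = y \<nu> - (\<Sum>k\<in>#\<nu>. w (k div 2))"
  have "a + (\<Sum>k\<in>#\<mu>. w (k div 2)) \<le> y \<mu>" if "\<mu> \<in> ?E" for \<mu>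
    using le[OF that] unfolding a_def by linarith
  moreover have "a + (\<Sum>k\<in>#\<nu>. w (k div 2)) = y \<nu>" by (simp add: a_def)
  ultimately show ?thesis using w by blast
qed

text \<open>Nonnegative combinations of the vectors of products \<open>p_\<mu>\<close> lie in the
  dual cone. At a scale \<open>T\<close> common to all \<open>j\<close>, weights
  \<open>exp (T * a j)\<close> produce the shifts, and the logarithm of a sum of \<open>l\<close>
  positive terms exceeds that of the largest term by at most \<open>ln l\<close>.\<close>

lemma tropical_combination_in_trop_BP_dual:
  fixes l :: nat
  assumes d: "d \<ge> 1" and l: "l > 0"
    and w: "\<And>j. j < l \<Longrightarrow> w j \<in> trop {1..d} (even_power_sum_region d)"
  shows "(\<lambda>\<mu>\<in>even_partitions (2 * d). MAX j\<in>{..<l}. a j + (\<Sum>k\<in>#\<mu>. w j (k div 2)))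
    \<in> trop (even_partitions (2 * d)) (BP_dual d)"
  unfolding trop_iff[OF finite_even_partitions]
proof (intro conjI allI impI)
  let ?E = "even_partitions (2 * d)"
  let ?P = power_sum_partition
  fix \<eta> T0 :: real assume "\<eta> > 0"
  \<comment> \<open>A partition has at most \<open>2 * d\<close> parts, so its accumulated error
    stays within \<open>(2 * d + 1) * \<epsilon> = \<eta> / 2\<close>.\<close>
  define \<epsilon> where "\<epsilon> = \<eta> / (2 * (2 * real d + 1))"
  have "\<epsilon> > 0" using \<open>\<eta> > 0\<close> by (simp add: \<epsilon>_def)
  have "\<forall>\<^sub>F T in at_top. \<forall>j\<in>{..<l}. \<exists>n x. \<forall>k\<in>{1..d}.
      power_sum (2 * k) n x > 0 \<and> \<bar>ln (power_sum (2 * k) n x) / T - w j k\<bar> < \<epsilon>"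
    by (intro eventually_ball_finite ballI trop_region_eventually d w \<open>\<epsilon> > 0\<close>) auto
  then have "\<forall>\<^sub>F T in at_top. (\<forall>j\<in>{..<l}. \<exists>n x. \<forall>k\<in>{1..d}.
      power_sum (2 * k) n x > 0 \<and> \<bar>ln (power_sum (2 * k) n x) / T - w j k\<bar> < \<epsilon>) \<and>
      T > max (max 0 T0) (2 * ln (real l) / \<eta>)"
    by (rule eventually_conj) (rule eventually_gt_at_top)
  then obtain T where "\<forall>j\<in>{..<l}. \<exists>n x. \<forall>k\<in>{1..d}.
      power_sum (2 * k) n x > 0 \<and> \<bar>ln (power_sum (2 * k) n x) / T - w j k\<bar> < \<epsilon>"
    and T: "T > 0" "T > T0" "T > 2 * ln (real l) / \<eta>"
    by (auto dest: eventually_happens)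
  then obtain n x where nx: "\<And>j k. j < l \<Longrightarrow> k \<in> {1..d} \<Longrightarrow> power_sum (2 * k) (n j) (x j) > 0"
    "\<And>j k. j < l \<Longrightarrow> k \<in> {1..d} \<Longrightarrow> \<bar>ln (power_sum (2 * k) (n j) (x j)) / T - w j k\<bar> < \<epsilon>"
    unfolding Ball_def lessThan_iff by metis
  define t where "t j \<mu> = exp (T * a j) * ?P \<mu> (n j) (x j)" for j \<mu>
  define \<phi> where "\<phi> = (\<lambda>\<mu>\<in>?E. \<Sum>j<l. t j \<mu>)"
  have "\<phi> \<in> BP_dual d"
    unfolding BP_dual_def
  proof (intro CollectI conjI ballI)
    fix c assume c: "c \<in> BP d"
    have "(\<Sum>\<mu>\<in>?E. c \<mu> * \<phi> \<mu>) = (\<Sum>\<mu>\<in>?E. \<Sum>j<l. c \<mu> * t j \<mu>)"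
      by (simp add: \<phi>_def sum_distrib_left)
    also have "\<dots> = (\<Sum>j<l. \<Sum>\<mu>\<in>?E. c \<mu> * t j \<mu>)" by (rule sum.swap)
    also have "\<dots> = (\<Sum>j<l. exp (T * a j) * (\<Sum>\<mu>\<in>?E. c \<mu> * ?P \<mu> (n j) (x j)))"
      by (simp add: t_def sum_distrib_left ac_simps)
    also have "\<dots> \<ge> 0"
      by (intro sum_nonneg mult_nonneg_nonneg BP_nonneg c) auto
    finally show "(\<Sum>\<mu>\<in>?E. c \<mu> * \<phi> \<mu>) \<ge> 0" .
  qed (simp add: \<phi>_def)
  moreover have "\<phi> \<mu> > 0 \<and> \<bar>ln (\<phi> \<mu>) / T - (MAX j\<in>{..<l}. a j + (\<Sum>k\<in>#\<mu>. w j (k div 2)))\<bar> < \<eta>"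
    if \<mu>: "\<mu> \<in> ?E" for \<mu>
  proof -
    define v where "v j = a j + (\<Sum>k\<in>#\<mu>. w j (k div 2))" for j
    define V where "V = (MAX j\<in>{..<l}. v j)"
    have t_pos: "t j \<mu> > 0" if "j < l" for j
      unfolding t_def using ln_power_sum_partition(1)[OF \<mu> nx(1)[OF that]] by simp
    have t_close: "\<bar>ln (t j \<mu>) / T - v j\<bar> \<le> \<eta> / 2" if j: "j < l" for j
    proof -
      have "ln (t j \<mu>) / T = a j + ln (?P \<mu> (n j) (x j)) / T"
        unfolding t_def using ln_power_sum_partition(1)[OF \<mu> nx(1)[OF j]] T(1)
        by (simp add: ln_mult_pos add_divide_distrib)
      then have "ln (t j \<mu>) / T - v j =
          (\<Sum>k\<in>#\<mu>. ln (power_sum (2 * (k div 2)) (n j) (x j)) / T) - (\<Sum>k\<in>#\<mu>. w j (k div 2))"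
        using ln_power_sum_partition(2)[OF \<mu> nx(1)[OF j], of T] by (simp add: v_def)
      then have "\<bar>ln (t j \<mu>) / T - v j\<bar> \<le> real (size \<mu>) * \<epsilon>"
        using nx(2)[OF j even_partitionsD(3)[OF \<mu>]]
        by (simp only:) (intro sum_mset_close ballI less_imp_le)
      also have "\<dots> \<le> (2 * real d + 1) * \<epsilon>"
        using size_le_even_partition[OF \<mu>] \<open>\<epsilon> > 0\<close> by (intro mult_right_mono) linarith+
      also have "\<dots> = \<eta> / 2" by (simp add: \<epsilon>_def field_simps)
      finally show ?thesis .
    qed
    have \<phi>\<mu>: "\<phi> \<mu> = (\<Sum>j<l. t j \<mu>)" using \<mu> by (simp add: \<phi>_def)
    have \<phi>_pos: "\<phi> \<mu> > 0" unfolding \<phi>\<mu> using l t_pos by (intro sum_pos) auto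
    have "V \<in> v ` {..<l}" unfolding V_def using l by (intro Max_in) auto
    then obtain j0 where j0: "j0 < l" "V = v j0" by auto
    \<comment> \<open>The lower bound needs only the term that realizes the maximum; the upper bound
      below replaces all \<open>l\<close> terms by a common bound.\<close>
    have "t j0 \<mu> \<le> \<phi> \<mu>"
      unfolding \<phi>\<mu> using j0(1) t_pos by (intro member_le_sum) (auto intro: less_imp_le)
    then have "ln (t j0 \<mu>) \<le> ln (\<phi> \<mu>)" using t_pos[OF j0(1)] by (intro ln_mono) auto
    then have "ln (t j0 \<mu>) / T \<le> ln (\<phi> \<mu>) / T" using T(1) by (intro divide_right_mono) auto
    with t_close[OF j0(1)] have lower: "V - \<eta> / 2 \<le> ln (\<phi> \<mu>) / T"
      using j0(2) unfolding abs_le_iff by linarith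
    have "t j \<mu> \<le> exp (T * (V + \<eta> / 2))" if j: "j < l" for j
    proof -
      have "v j \<le> V" unfolding V_def using j by (intro Max_ge) auto
      with t_close[OF j] have "ln (t j \<mu>) / T \<le> V + \<eta> / 2" unfolding abs_le_iff by linarith
      then have "ln (t j \<mu>) \<le> T * (V + \<eta> / 2)" using T(1) by (simp add: divide_le_eq mult.commute)
      then have "exp (ln (t j \<mu>)) \<le> exp (T * (V + \<eta> / 2))" by simp
      then show ?thesis using t_pos[OF j] by simp
    qed
    then have "\<phi> \<mu> \<le> real l * exp (T * (V + \<eta> / 2))"
      unfolding \<phi>\<mu> using sum_bounded_above[of "{..<l}" "\<lambda>j. t j \<mu>"] by simp
    then have "ln (\<phi> \<mu>) \<le> ln (real l * exp (T * (V + \<eta> / 2)))"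
      using \<phi>_pos by (intro ln_mono) auto
    also have "\<dots> = ln (real l) + T * (V + \<eta> / 2)"
      using l by (simp add: ln_mult_pos)
    also have "\<dots> < T * (V + \<eta>)"
      using T(3) \<open>\<eta> > 0\<close> by (simp add: divide_less_eq algebra_simps)
    finally have "ln (\<phi> \<mu>) / T < V + \<eta>" using T(1) by (simp add: divide_less_eq mult.commute)
    with lower \<phi>_pos \<open>\<eta> > 0\<close> show ?thesis
      unfolding v_def[symmetric] V_def[symmetric] abs_less_iff by linarith
  qed
  ultimately show "\<exists>T>T0. \<exists>\<phi>\<in>BP_dual d. \<forall>\<mu>\<in>?E. \<phi> \<mu> > 0 \<and>
      \<bar>ln (\<phi> \<mu>) / T - (\<lambda>\<mu>\<in>?E. MAX j\<in>{..<l}. a j + (\<Sum>k\<in>#\<mu>. w j (k div 2))) \<mu>\<bar> < \<eta>"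
    using T(2) by (intro exI[of _ T] conjI bexI[of _ \<phi>]) simp_all
qed simp

section \<open>Identification of coordinates and the two inclusions\<close>

lemma along_halving_image:
  "along_halving d ` (partitions d \<rightarrow>\<^sub>E UNIV) = even_partitions (2 * d) \<rightarrow>\<^sub>E UNIV"
proof (intro equalityI subsetI)
  fix y :: "nat multiset \<Rightarrow> real" assume y: "y \<in> even_partitions (2 * d) \<rightarrow>\<^sub>E UNIV"
  let ?h = "image_mset (\<lambda>k::nat. k div 2)"
  define g where "g = (\<lambda>\<mu>\<in>partitions d. y (inv_into (even_partitions (2 * d)) ?h \<mu>))"
  have "along_halving d g = y"
    by (rule extensionalityI[of _ "even_partitions (2 * d)"])
      (use y bij_betw_halving[of d] in
        \<open>auto simp: along_halving_def g_def PiE_def bij_betw_def inv_into_f_f\<close>)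
  then show "y \<in> along_halving d ` (partitions d \<rightarrow>\<^sub>E UNIV)"
    by (intro image_eqI[of _ _ g]) (auto simp: g_def)
qed (auto simp: along_halving_def)

lemma along_halving_trop_nu:
  assumes "\<mu> \<in> even_partitions (2 * d)"
  shows "trop_nu d w (image_mset (\<lambda>k. k div 2) \<mu>) = (\<Sum>k\<in>#\<mu>. w (k div 2))"
proof -
  have "image_mset (\<lambda>k. k div 2) \<mu> \<in> partitions d"
    using bij_betw_apply[OF bij_betw_halving assms] .
  then show ?thesis by (simp add: trop_nu_def multiset.map_comp o_def)
qed

theorem proposition5p4:
  fixes d :: nat
  assumes "d \<ge> 1"
  shows "trop (even_partitions (2 * d)) (BP_dual d) =
    along_halving d ` tcone (partitions d) (trop_nu d ` trop {1..d} (even_power_sum_region d))"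
proof (intro equalityI subsetI)
  let ?E = "even_partitions (2 * d)"
  let ?h = "image_mset (\<lambda>k::nat. k div 2)"
  fix y assume y: "y \<in> trop ?E (BP_dual d)"
  then have "y \<in> ?E \<rightarrow>\<^sub>E UNIV" by (simp add: trop_def)
  \<comment> \<open>\<open>g\<close> is \<open>y\<close> read on the partitions of \<open>d\<close>,
    where the tropical cone lives.\<close>
  then obtain g where g: "g \<in> partitions d \<rightarrow>\<^sub>E UNIV" "y = along_halving d g"
    unfolding along_halving_image[symmetric] by blast
  have yg: "y \<mu> = g (?h \<mu>)" if "\<mu> \<in> ?E" for \<mu> using that by (simp add: g(2) along_halving_def)
  have h: "?h ` ?E = partitions d" using bij_betw_halving by (rule bij_betw_imp_surj_on)
  have "g \<in> tcone (partitions d) (trop_nu d ` trop {1..d} (even_power_sum_region d))"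
  proof (rule tcone_of_pointwise[OF finite_partitions _ g(1)])
    show "partitions d \<noteq> {}" using replicate_in_even_partitions[of d] h by blast
    fix \<kappa> assume "\<kappa> \<in> partitions d"
    then obtain \<nu> where \<nu>: "\<nu> \<in> ?E" "\<kappa> = ?h \<nu>" using h by blast
    obtain a w where w: "w \<in> trop {1..d} (even_power_sum_region d)"
      and le: "\<And>\<mu>. \<mu> \<in> ?E \<Longrightarrow> a + trop_nu d w (?h \<mu>) \<le> g (?h \<mu>)"
      and eq: "a + trop_nu d w \<kappa> = g \<kappa>"
      using trop_BP_dual_pointwise[OF assms y \<nu>(1)] yg \<nu>
      by (auto simp: along_halving_trop_nu)
    have "\<forall>\<mu>\<in>partitions d. a + trop_nu d w \<mu> \<le> g \<mu>" unfolding h[symmetric] using le by blast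
    with w eq show "\<exists>a. \<exists>x\<in>trop_nu d ` trop {1..d} (even_power_sum_region d).
        (\<forall>\<mu>\<in>partitions d. a + x \<mu> \<le> g \<mu>) \<and> a + x \<kappa> = g \<kappa>"
      by blast
  qed
  then show "y \<in> along_halving d ` tcone (partitions d) (trop_nu d ` trop {1..d} (even_power_sum_region d))"
    using g(2) by blast
next
  let ?E = "even_partitions (2 * d)"
  fix y assume "y \<in> along_halving d ` tcone (partitions d) (trop_nu d ` trop {1..d} (even_power_sum_region d))"
  then obtain l :: nat and a x where l: "l > 0"
    and x: "\<forall>j<l. x j \<in> trop_nu d ` trop {1..d} (even_power_sum_region d)"
    and y: "y = along_halving d (\<lambda>\<mu>\<in>partitions d. MAX j\<in>{..<l}. a j + x j \<mu>)"
    unfolding tcone_def by blast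
  have "\<forall>j. \<exists>w. j < l \<longrightarrow> w \<in> trop {1..d} (even_power_sum_region d) \<and> x j = trop_nu d w"
    using x by blast
  then obtain w where w: "\<And>j. j < l \<Longrightarrow> w j \<in> trop {1..d} (even_power_sum_region d)"
    and xw: "\<And>j. j < l \<Longrightarrow> x j = trop_nu d (w j)"
    by metis
  \<comment> \<open>Read on even partitions, the tropical combination takes the form required by
    \<open>tropical_combination_in_trop_BP_dual\<close>.\<close>
  have "y = (\<lambda>\<mu>\<in>?E. MAX j\<in>{..<l}. a j + (\<Sum>k\<in>#\<mu>. w j (k div 2)))"
    unfolding y along_halving_def
  proof (rule restrict_ext)
    fix \<mu> assume \<mu>: "\<mu> \<in> ?E"
    have "(\<lambda>j. a j + x j (image_mset (\<lambda>k. k div 2) \<mu>)) ` {..<l} =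
        (\<lambda>j. a j + (\<Sum>k\<in>#\<mu>. w j (k div 2))) ` {..<l}"
      by (rule image_cong) (simp_all add: xw along_halving_trop_nu[OF \<mu>])
    then show "(\<lambda>\<mu>\<in>partitions d. MAX j\<in>{..<l}. a j + x j \<mu>) (image_mset (\<lambda>k. k div 2) \<mu>) =
        (MAX j\<in>{..<l}. a j + (\<Sum>k\<in>#\<mu>. w j (k div 2)))"
      using bij_betw_apply[OF bij_betw_halving \<mu>] by simp
  qed
  then show "y \<in> trop ?E (BP_dual d)"
    using tropical_combination_in_trop_BP_dual[OF assms l w] by simp
qed

end
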